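(* For every topological space $X$: if $X$ is $k_2$-Hausdorff then $X$ is UOK; if $X$ is UOK then $X$ is UCR; and if $X$ is UCR then $X$ is US.
   Context: No separation axioms are assumed unless stated. A space $X$ is $k_2$-Hausdorff if for every compact Hausdorff space $K$, every continuous map $f:K\to X$, and all points $k,l\in K$ with $f(k)\neq f(l)$, there exist open neighborhoods $U$ of $k$ and $V$ of $l$ in $K$ with $f[U]\cap f[V]=\emptyset$. A space $X$ is UOK if for every non-compact, locally compact Hausdorff space $L$ and every continuous function $f:L\to X$, there exists at most one continuous extension $\hat f:\hat L\to X$ of $f$, where $\hat L=L\cup\{\infty\}$ is the one-point compactification of $L$. A transfinite sequence in $X$ is a function $f:\lambda\to X$ from some limit ordinal $\lambda$ into $X$; it is continuous if it is continuous with respect to the order topology on $\lambda$. A point $x\in X$ is a limit of $f$ if for every neighborhood $U$ of $x$ there is $\beta<\lambda$ with $f(\gamma)\in U$ for all $\gamma$ with $\beta\leq\gamma<\lambda$. A space $X$ is UCR if every continuous transfinite sequence in $X$ has at most one limit. A space $X$ is US if every convergent sequence $\omega\to X$ has exactly one limit. *)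

theory Defs
  imports "HOL-Analysis.Analysis"
begin

text \<open>
  The notions below quantify over all compact Hausdorff spaces, over all locally compact
  Hausdorff spaces, and over all ordinals. HOL cannot quantify over types inside a formula, so
  these test objects are taken from a universe, the type \<open>'u\<close>: spaces are topologies
  whose carrier is an arbitrary subset of \<open>'u\<close>, and ordinals are well-orders whose field
  is an arbitrary subset of \<open>'u\<close>. The universe is unrelated to the type \<open>'a\<close>
  of the points of the space under consideration.
\<close>

definition k2_Hausdorff :: "'u itself \<Rightarrow> 'a topology \<Rightarrow> bool" where
  "k2_Hausdorff _ X \<longleftrightarrow>
     (\<forall>(K :: 'u topology) f. compact_space K \<and> Hausdorff_space K \<and> continuous_map K X f \<longrightarrow>
        (\<forall>k \<in> topspace K. \<forall>l \<in> topspace K. f k \<noteq> f l \<longrightarrow>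
           (\<exists>U V. openin K U \<and> k \<in> U \<and> openin K V \<and> l \<in> V \<and> f ` U \<inter> f ` V = {})))"

text \<open>
  In the Alexandroff compactification of \<open>L\<close>, the points of \<open>L\<close> are embedded by
  \<open>Some\<close> and \<open>None\<close> is the point at infinity. Functions in HOL are total, so
  two extensions are the same if they agree on the underlying set of the compactification.
\<close>

definition extends_to_Alexandroff ::
  "'u topology \<Rightarrow> 'a topology \<Rightarrow> ('u \<Rightarrow> 'a) \<Rightarrow> ('u option \<Rightarrow> 'a) \<Rightarrow> bool" where
  "extends_to_Alexandroff L X f g \<longleftrightarrow>
     continuous_map (Alexandroff_compactification L) X g \<and> (\<forall>x \<in> topspace L. g (Some x) = f x)"

definition UOK_space :: "'u itself \<Rightarrow> 'a topology \<Rightarrow> bool" where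
  "UOK_space _ X \<longleftrightarrow>
     (\<forall>(L :: 'u topology) f.
        \<not> compact_space L \<and> locally_compact_space L \<and> Hausdorff_space L \<and> continuous_map L X f \<longrightarrow>
        (\<forall>g h. extends_to_Alexandroff L X f g \<and> extends_to_Alexandroff L X f h \<longrightarrow>
           (\<forall>z \<in> topspace (Alexandroff_compactification L). g z = h z)))"

text \<open>
  Well-orders are reflexive relations, as in the library. The whole field is included in the
  subbasis below because the open rays alone do not cover a one-element order.
\<close>

definition order_topology_of :: "'u rel \<Rightarrow> 'u topology" where
  "order_topology_of r =
     topology_generated_by ({Field r} \<union> (underS r ` Field r) \<union> (aboveS r ` Field r))"

definition limit_ordinal :: "'u rel \<Rightarrow> bool" where
  "limit_ordinal r \<longleftrightarrow>
     Well_order r \<and> Field r \<noteq> {} \<and> \<not> (\<exists>m \<in> Field r. \<forall>a \<in> Field r. (a, m) \<in> r)"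

definition transfinite_limit :: "'u rel \<Rightarrow> 'a topology \<Rightarrow> ('u \<Rightarrow> 'a) \<Rightarrow> 'a \<Rightarrow> bool" where
  "transfinite_limit r X f x \<longleftrightarrow>
     x \<in> topspace X \<and>
     (\<forall>U. openin X U \<and> x \<in> U \<longrightarrow>
        (\<exists>b \<in> Field r. \<forall>c \<in> Field r. (b, c) \<in> r \<longrightarrow> f c \<in> U))"

definition UCR_space :: "'u itself \<Rightarrow> 'a topology \<Rightarrow> bool" where
  "UCR_space _ X \<longleftrightarrow>
     (\<forall>(r :: 'u rel) f. limit_ordinal r \<and> continuous_map (order_topology_of r) X f \<longrightarrow>
        (\<forall>x y. transfinite_limit r X f x \<and> transfinite_limit r X f y \<longrightarrow> x = y))"

definition US_space :: "'a topology \<Rightarrow> bool" where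
  "US_space X \<longleftrightarrow>
     (\<forall>s :: nat \<Rightarrow> 'a. range s \<subseteq> topspace X \<and> (\<exists>x. limitin X s x sequentially) \<longrightarrow>
        (\<exists>!x. limitin X s x sequentially))"

end

theory Submission
  imports Defs
begin

text \<open>
  Two extensions of \<open>f : L \<rightarrow> X\<close> to the one-point compactification of \<open>L\<close> define one map on two
  disjoint copies of that compactification. Neighbourhoods of the two points at infinity both meet
  \<open>L\<close>, and in a common point since \<open>L\<close> is not compact; hence their images meet, and
  \<open>k\<^sub>2\<close>-Hausdorffness forces the two values at infinity to agree. A limit ordinal is a
  non-compact, locally compact Hausdorff space in which sets bounded by a point lie in a compact
  set, so a limit of a continuous transfinite sequence is the same as an extension to the one-point
  compactification. Finally, \<open>\<omega>\<close> is a discrete limit ordinal.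
\<close>

section \<open>Test spaces transported into the universe\<close>

text \<open>On \<open>range e\<close> the map \<open>inv e\<close> is a bijection, so pulling
  \<open>Y\<close> back along it only renames points. This turns a space of another type into one
  carried by a subset of \<open>'u\<close>.\<close>

lemma homeomorphic_copy:
  fixes Y :: "'v topology" and e :: "'v \<Rightarrow> 'u"
  assumes "inj e"
  shows "homeomorphic_maps Y (pullback_topology (range e) (inv e) Y) e (inv e)"
proof -
  have "continuous_map Y Y (inv e \<circ> e)"
    using assms by simp
  then have "continuous_map Y (pullback_topology (range e) (inv e) Y) e"
    by (rule continuous_map_pullback') auto
  moreover have "continuous_map (pullback_topology (range e) (inv e) Y) Y (id \<circ> inv e)"
    by (rule continuous_map_pullback) (simp add: continuous_map_id)
  ultimately show ?thesis
    using assms by (auto simp: homeomorphic_maps_def topspace_pullback_topology)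
qed

text \<open>The definition tests only spaces inside \<open>'u\<close>. Any type that injects into
  \<open>'u\<close> becomes available: test \<open>f \<circ> inv e\<close> on the copy and pull the
  separating sets back along \<open>e\<close>.\<close>

lemma k2_Hausdorff_separation:
  fixes Y :: "'v topology" and e :: "'v \<Rightarrow> 'u"
  assumes "k2_Hausdorff TYPE('u) X" and e: "inj e"
    and Y: "compact_space Y" "Hausdorff_space Y" "continuous_map Y X f"
    and kl: "k \<in> topspace Y" "l \<in> topspace Y" "f k \<noteq> f l"
  obtains U V where "openin Y U" "k \<in> U" "openin Y V" "l \<in> V" "f ` U \<inter> f ` V = {}"
proof -
  define K where "K = pullback_topology (range e) (inv e) Y"
  have hom: "homeomorphic_maps Y K e (inv e)"
    unfolding K_def by (rule homeomorphic_copy[OF e])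
  then have YK: "Y homeomorphic_space K"
    by (auto simp: homeomorphic_space_def)
  have cont: "continuous_map Y K e" "continuous_map K Y (inv e)"
    using hom by (auto simp: homeomorphic_maps_def)
  have "compact_space K" "Hausdorff_space K"
    using Y YK homeomorphic_compact_space homeomorphic_Hausdorff_space by blast+
  moreover have "continuous_map K X (f \<circ> inv e)"
    using cont(2) Y(3) continuous_map_compose by blast
  moreover have "e k \<in> topspace K" "e l \<in> topspace K"
    using cont(1) kl continuous_map_image_subset_topspace by blast+
  moreover have "(f \<circ> inv e) (e k) \<noteq> (f \<circ> inv e) (e l)"
    using kl e by simp
  ultimately obtain U V where UV: "openin K U" "e k \<in> U" "openin K V" "e l \<in> V"
      "(f \<circ> inv e) ` U \<inter> (f \<circ> inv e) ` V = {}"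
    using assms(1) unfolding k2_Hausdorff_def by metis
  have im: "f ` {y \<in> topspace Y. e y \<in> W} \<subseteq> (f \<circ> inv e) ` W" for W
  proof
    fix z
    assume "z \<in> f ` {y \<in> topspace Y. e y \<in> W}"
    then obtain y where "z = (f \<circ> inv e) (e y)" "e y \<in> W"
      using e by auto
    then show "z \<in> (f \<circ> inv e) ` W"
      by blast
  qed
  show thesis
  proof
    show "openin Y {y \<in> topspace Y. e y \<in> U}" "openin Y {y \<in> topspace Y. e y \<in> V}"
      using cont(1) UV openin_continuous_map_preimage by blast+
    show "k \<in> {y \<in> topspace Y. e y \<in> U}" "l \<in> {y \<in> topspace Y. e y \<in> V}"
      using UV kl by auto
    show "f ` {y \<in> topspace Y. e y \<in> U} \<inter> f ` {y \<in> topspace Y. e y \<in> V} = {}"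
      using UV(5) im by blast
  qed
qed

text \<open>Two copies of the compactification live in \<open>'u option \<times> bool\<close>. They
  fit into \<open>'u\<close> because an infinite cardinal absorbs its own double.\<close>

lemma inj_option_times_bool:
  assumes "infinite (UNIV :: 'u set)"
  obtains e :: "'u option \<times> bool \<Rightarrow> 'u" where "inj e"
proof -
  have "\<exists>j. inj_on j ((UNIV :: 'u set) <+> (UNIV :: 'u set)) \<and>
      j ` ((UNIV :: 'u set) <+> (UNIV :: 'u set)) \<subseteq> (UNIV :: 'u set)"
    unfolding card_of_ordLeq
    by (intro ordIso_imp_ordLeq card_of_Plus_infinite1 assms card_of_mono1 subset_UNIV)
  then obtain j :: "'u + 'u \<Rightarrow> 'u" where "inj j"
    by (auto simp: UNIV_Plus_UNIV)
  then have j: "j x = j y \<longleftrightarrow> x = y" for x y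
    by (simp add: inj_eq)
  \<comment> \<open>The left summand holds the points \<open>Some x\<close>, which leaves any single
    point of the right summand free for \<open>None\<close>. The same coding into two summands is
    applied once more for the Boolean.\<close>
  define i where "i z = (case z of None \<Rightarrow> j (Inr undefined) | Some x \<Rightarrow> j (Inl x))" for z
  have i: "i x = i y \<longleftrightarrow> x = y" for x y
    by (auto simp: i_def j split: option.splits)
  have "inj (\<lambda>(z, b). j (if b then Inl (i z) else Inr (i z)))"
    by (auto simp: inj_on_def i j split: if_splits)
  then show thesis
    by (rule that)
qed

section \<open>From k_2-Hausdorff to UOK\<close>

text \<open>The product with discrete \<open>bool\<close> serves as the disjoint sum of two copies
  of \<open>Y\<close>. A preimage splits into one open slice per copy.\<close>

lemma continuous_map_two_copies:
  assumes g: "continuous_map Y X g" and h: "continuous_map Y X h"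
  shows "continuous_map (prod_topology Y (discrete_topology (UNIV :: bool set))) X
           (\<lambda>(z, b). if b then g z else h z)"
  unfolding continuous_map_def
proof (intro conjI allI impI)
  show "(\<lambda>(z, b). if b then g z else h z)
      \<in> topspace (prod_topology Y (discrete_topology (UNIV :: bool set))) \<rightarrow> topspace X"
    using g h by (auto simp: continuous_map_def Pi_iff)
next
  fix W
  assume W: "openin X W"
  have "{p \<in> topspace (prod_topology Y (discrete_topology (UNIV :: bool set))).
          (case p of (z, b) \<Rightarrow> if b then g z else h z) \<in> W}
      = {z \<in> topspace Y. g z \<in> W} \<times> {True} \<union> {z \<in> topspace Y. h z \<in> W} \<times> {False}"
    by (auto split: if_splits)
  moreover have "openin (prod_topology Y (discrete_topology (UNIV :: bool set))) \<dots>"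
    using W g h openin_continuous_map_preimage
    by (intro openin_Un) (auto simp: openin_prod_Times_iff)
  ultimately show "openin (prod_topology Y (discrete_topology (UNIV :: bool set)))
      {p \<in> topspace (prod_topology Y (discrete_topology (UNIV :: bool set))).
          (case p of (z, b) \<Rightarrow> if b then g z else h z) \<in> W}"
    by simp
qed

text \<open>A non-compact space is dense in its one-point compactification.\<close>

lemma Alexandroff_neighbourhood_infinity_meets:
  assumes "\<not> compact_space L" and "openin (Alexandroff_compactification L) W" "None \<in> W"
  obtains x where "x \<in> topspace L" "Some x \<in> W"
proof -
  have "None \<in> Alexandroff_compactification L closure_of (Some ` topspace L)"
    using Alexandroff_compactification_dense[OF assms(1)] by simp
  then show thesis
    using assms(2,3) that by (auto simp: in_closure_of)
qed

lemma k2_Hausdorff_imp_UOK: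
  fixes X :: "'a topology"
  assumes universe: "infinite (UNIV :: 'u set)" and X: "k2_Hausdorff TYPE('u) X"
  shows "UOK_space TYPE('u) X"
  unfolding UOK_space_def
proof (intro allI impI ballI, elim conjE)
  fix L :: "'u topology" and f g h z
  assume L: "\<not> compact_space L" "locally_compact_space L" "Hausdorff_space L"
    and g: "extends_to_Alexandroff L X f g" and h: "extends_to_Alexandroff L X f h"
    and z: "z \<in> topspace (Alexandroff_compactification L)"
  define A where "A = Alexandroff_compactification L"
  define Y where "Y = prod_topology A (discrete_topology (UNIV :: bool set))"
  define p where "p = (\<lambda>(z, b). if b then g z else h z)"
  have gh: "g (Some x) = h (Some x)" if "x \<in> topspace L" for x
    using g h that by (simp add: extends_to_Alexandroff_def)
  have "g None = h None"
  proof (rule ccontr)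
    assume "g None \<noteq> h None"
    obtain e :: "'u option \<times> bool \<Rightarrow> 'u" where e: "inj e"
      using inj_option_times_bool[OF universe] by blast
    \<comment> \<open>Local compactness and Hausdorffness of \<open>L\<close> together make the
      compactification Hausdorff, hence an admissible test space.\<close>
    have "compact_space A" "Hausdorff_space A"
      using L by (auto simp: A_def Hausdorff_space_Alexandroff_compactification)
    then have "compact_space Y" "Hausdorff_space Y"
      by (auto simp: Y_def compact_space_prod_topology Hausdorff_space_prod_topology
          compact_space_discrete_topology)
    moreover have "continuous_map Y X p"
      unfolding Y_def p_def using g h
      by (intro continuous_map_two_copies) (auto simp: A_def extends_to_Alexandroff_def)
    moreover have "(None, True) \<in> topspace Y" "(None, False) \<in> topspace Y"
      by (auto simp: Y_def A_def)
    moreover have "p (None, True) \<noteq> p (None, False)"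
      using \<open>g None \<noteq> h None\<close> by (simp add: p_def)
    ultimately obtain U V where UV: "openin Y U" "(None, True) \<in> U" "openin Y V"
        "(None, False) \<in> V" "p ` U \<inter> p ` V = {}"
      by (rule k2_Hausdorff_separation[OF X e])
    from UV(1,2) obtain U' B where U': "openin A U'" "None \<in> U'" "True \<in> B" "U' \<times> B \<subseteq> U"
      unfolding Y_def openin_prod_topology_alt by blast
    from UV(3,4) obtain V' C where V': "openin A V'" "None \<in> V'" "False \<in> C" "V' \<times> C \<subseteq> V"
      unfolding Y_def openin_prod_topology_alt by blast
    \<comment> \<open>Without the Boolean coordinate both sets are neighbourhoods of the same point
      \<open>None\<close>. A point of \<open>L\<close> in both has one copy in \<open>U\<close> and
      one in \<open>V\<close>, with equal images.\<close>
    have "openin A (U' \<inter> V')"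
      using U' V' by blast
    with U' V' obtain x where x: "x \<in> topspace L" "Some x \<in> U' \<inter> V'"
      using Alexandroff_neighbourhood_infinity_meets[OF L(1), of "U' \<inter> V'"]
      unfolding A_def by blast
    then have "p (Some x, True) \<in> p ` U" "p (Some x, False) \<in> p ` V"
      using U' V' by auto
    moreover have "p (Some x, True) = p (Some x, False)"
      using gh x by (simp add: p_def)
    ultimately show False
      using UV(5) by auto
  qed
  with gh z show "g z = h z"
    by auto
qed

section \<open>The order topology of a well-order\<close>

lemma topspace_order_topology_of [simp]: "topspace (order_topology_of r) = Field r"
  by (auto simp: order_topology_of_def underS_def aboveS_def Field_def)

lemma openin_underS: "a \<in> Field r \<Longrightarrow> openin (order_topology_of r) (underS r a)"
  unfolding order_topology_of_def by (rule topology_generated_by_Basis) auto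

lemma openin_aboveS: "a \<in> Field r \<Longrightarrow> openin (order_topology_of r) (aboveS r a)"
  unfolding order_topology_of_def by (rule topology_generated_by_Basis) auto

context wo_rel
begin

lemma not_in_iff:
  assumes "a \<in> Field r" "b \<in> Field r"
  shows "(a, b) \<notin> r \<longleftrightarrow> b \<noteq> a \<and> (b, a) \<in> r"
  using assms TOTALS ANTISYM REFL by (metis antisymD refl_onD)

text \<open>Only the part of \<open>U\<close> below \<open>a\<close> is described: it contains a
  half-open interval ending at \<open>a\<close>, or the whole segment up to \<open>a\<close>. This
  suffices for compactness of initial segments. The proof is by induction on the generation of
  \<open>U\<close> from rays.\<close>

lemma order_topology_neighbourhood:
  assumes U: "openin (order_topology_of r) U" and a: "a \<in> U"
  shows "under a \<subseteq> U \<or> (\<exists>c. c \<in> underS a \<and> under a \<inter> aboveS c \<subseteq> U)"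
proof -
  have "generate_topology_on ({Field r} \<union> underS ` Field r \<union> aboveS ` Field r) U"
    using U unfolding order_topology_of_def by (rule openin_topology_generated_by)
  then show ?thesis
    using a
  proof (induction arbitrary: a)
    case Empty
    then show ?case by simp
  next
    case (Int S T)
    have "under a \<subseteq> S \<or> (\<exists>c. c \<in> underS a \<and> under a \<inter> aboveS c \<subseteq> S)"
      "under a \<subseteq> T \<or> (\<exists>c. c \<in> underS a \<and> under a \<inter> aboveS c \<subseteq> T)"
      using Int by auto
    moreover have "under a \<subseteq> S \<inter> T \<or> (\<exists>c. c \<in> underS a \<and> under a \<inter> aboveS c \<subseteq> S \<inter> T)"
      if c: "c \<in> underS a" "under a \<inter> aboveS c \<subseteq> S"
        and d: "d \<in> underS a" "under a \<inter> aboveS d \<subseteq> T" for c d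
    \<comment> \<open>The larger of the two lower bounds works for both sets.\<close>
    proof (cases "(c, d) \<in> r")
      case True
      then have "aboveS d \<subseteq> aboveS c"
        using TRANS ANTISYM unfolding aboveS_def by (auto dest: transD antisymD)
      then show ?thesis using c d by blast
    next
      case False
      then have "(d, c) \<in> r"
        using c d TOTALS unfolding underS_def Field_def by blast
      then have "aboveS c \<subseteq> aboveS d"
        using TRANS ANTISYM unfolding aboveS_def by (auto dest: transD antisymD)
      then show ?thesis using c d by blast
    qed
    ultimately show ?case by blast
  next
    case (UN K)
    then show ?case by (meson Union_iff Union_upper subset_trans)
  next
    case (Basis S)
    then consider "S = Field r" | b where "S = underS b" | b where "S = aboveS b"
      by blast
    then show ?case
    proof cases
      case 1
      then show ?thesis by (auto simp: under_def Field_def)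
    next
      case 2
      \<comment> \<open>A lower ray is downward closed; for an upper ray, treated next, its endpoint
        \<open>b\<close> is the required lower bound.\<close>
      then have "under a \<subseteq> S"
        using Basis.prems TRANS ANTISYM unfolding under_def underS_def
        by (auto dest: transD antisymD)
      then show ?thesis by simp
    next
      case 3
      then have "b \<in> underS a"
        using Basis.prems by (auto simp: underS_def aboveS_def)
      then show ?thesis using 3 by blast
    qed
  qed
qed

text \<open>A member of the cover that contains \<open>a\<close> absorbs everything in
  \<open>under a\<close> above some \<open>c < a\<close>; by well-founded induction finitely many
  members cover the remaining segment \<open>under c\<close>.\<close>

lemma compactin_under: "compactin (order_topology_of r) (under a)"
proof (induction a rule: well_order_induct)
  case (1 a)
  show ?case
  proof (cases "a \<in> Field r")
    \<comment> \<open>The induction ranges over the whole type, so points outside the field occur;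
      their segments are empty.\<close>
    case False
    then have "under a = {}"
      by (auto simp: under_def Field_def)
    then show ?thesis by simp
  next
    case True
    show ?thesis
      unfolding compactin_def
    proof (intro conjI allI impI, goal_cases)
      case 1
      then show ?case by (auto simp: under_def Field_def)
    next
      case (2 \<U>)
      have "a \<in> under a"
        using True REFL by (auto simp: under_def refl_on_def)
      with 2 obtain U where U: "U \<in> \<U>" "a \<in> U" "openin (order_topology_of r) U"
        by blast
      from order_topology_neighbourhood[OF U(3,2)]
      show ?case
      proof (elim disjE exE conjE)
        assume "under a \<subseteq> U"
        with U show ?case
          by (intro exI[of _ "{U}"]) auto
      next
        fix c
        assume c: "c \<in> underS a" "under a \<inter> aboveS c \<subseteq> U"
        have sub: "under a \<subseteq> under c \<union> (under a \<inter> aboveS c)"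
        proof
          fix x
          assume x: "x \<in> under a"
          then have "x \<in> Field r" "c \<in> Field r"
            using c by (auto simp: under_def underS_def Field_def)
          with not_in_iff[of x c] x show "x \<in> under c \<union> (under a \<inter> aboveS c)"
            by (auto simp: under_def aboveS_def)
        qed
        have "under c \<subseteq> under a"
          using c TRANS by (auto simp: under_def underS_def dest: transD)
        with 2 have cov: "under c \<subseteq> \<Union>\<U>"
          by blast
        have "compactin (order_topology_of r) (under c)"
          using "1" c by (auto simp: underS_def)
        with 2 cov obtain \<F> where \<F>: "finite \<F>" "\<F> \<subseteq> \<U>" "under c \<subseteq> \<Union>\<F>"
          unfolding compactin_def by blast
        then show ?case
          using U c(2) sub by (intro exI[of _ "insert U \<F>"]) auto
      qed
    qed
  qed
qed

text \<open>For \<open>a < b\<close>, cut at a point strictly between them if there is one.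
  Otherwise the rays below \<open>b\<close> and above \<open>a\<close> are already disjoint.\<close>

lemma Hausdorff_order_topology: "Hausdorff_space (order_topology_of r)"
proof -
  have sep: "\<exists>U V. openin (order_topology_of r) U \<and> openin (order_topology_of r) V \<and>
      a \<in> U \<and> b \<in> V \<and> disjnt U V"
    if ab: "a \<in> Field r" "b \<in> Field r" "a \<noteq> b" "(a, b) \<in> r" for a b
  proof (cases "\<exists>c. c \<in> underS b \<inter> aboveS a")
    case True
    then obtain c where c: "c \<in> underS b" "c \<in> aboveS a"
      by blast
    then have "c \<in> Field r"
      by (auto simp: underS_def Field_def)
    moreover have "a \<in> underS c" "b \<in> aboveS c"
      using c by (auto simp: underS_def aboveS_def)
    moreover have "disjnt (underS c) (aboveS c)"
      using ANTISYM by (auto simp: underS_def aboveS_def disjnt_iff dest: antisymD)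
    ultimately show ?thesis
      using openin_underS[of c r] openin_aboveS[of c r] by blast
  next
    case False
    moreover have "a \<in> underS b" "b \<in> aboveS a"
      using ab by (auto simp: underS_def aboveS_def)
    moreover have "disjnt (underS b) (aboveS a)"
      using False by (auto simp: disjnt_iff)
    ultimately show ?thesis
      using ab openin_underS[of b r] openin_aboveS[of a r] by blast
  qed
  show ?thesis
    unfolding Hausdorff_space_def topspace_order_topology_of
  proof (intro allI impI, elim conjE)
    fix a b
    assume ab: "a \<in> Field r" "b \<in> Field r" "a \<noteq> b"
    show "\<exists>U V. openin (order_topology_of r) U \<and> openin (order_topology_of r) V \<and>
      a \<in> U \<and> b \<in> V \<and> disjnt U V"
    proof (cases "(a, b) \<in> r")
      case True
      with sep ab show ?thesis by blast
    next
      case False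
      then have "(b, a) \<in> r"
        using TOTALS ab by blast
      then obtain U V where "openin (order_topology_of r) U" "openin (order_topology_of r) V"
          "b \<in> U" "a \<in> V" "disjnt U V"
        using sep[of b a] ab by auto
      then show ?thesis
        using disjnt_sym by blast
    qed
  qed
qed

end

section \<open>Limit ordinals as locally compact, non-compact spaces\<close>

lemma limit_ordinal_wo_rel: "limit_ordinal r \<Longrightarrow> wo_rel r"
  by (simp add: limit_ordinal_def wo_rel_def)

lemma limit_ordinal_aboveS:
  assumes r: "limit_ordinal r" and a: "a \<in> Field r"
  obtains b where "b \<in> aboveS r a"
proof -
  interpret wo_rel r
    using r by (rule limit_ordinal_wo_rel)
  obtain b where "b \<in> Field r" "(b, a) \<notin> r"
    using r a by (auto simp: limit_ordinal_def)
  with not_in_iff[of b a] a have "b \<in> aboveS a"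
    by (auto simp: aboveS_def)
  then show thesis
    by (rule that)
qed

text \<open>Since there is no largest element, \<open>a\<close> has a successor \<open>s\<close>,
  and the closed segment up to \<open>a\<close> is the open ray below \<open>s\<close>.\<close>

lemma openin_under:
  assumes r: "limit_ordinal r" and a: "a \<in> Field r"
  shows "openin (order_topology_of r) (under r a)"
proof -
  interpret wo_rel r
    using r by (rule limit_ordinal_wo_rel)
  define s where "s = minim (aboveS a)"
  have sub: "aboveS a \<subseteq> Field r"
    by (auto simp: aboveS_def Field_def)
  obtain b where "b \<in> aboveS a"
    using limit_ordinal_aboveS[OF r a] by blast
  then have s: "s \<in> aboveS a"
    using minim_in[OF sub] by (auto simp: s_def)
  then have sF: "s \<in> Field r"
    using sub by blast
  have "under a = underS s"
  proof (intro set_eqI iffI)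
    fix x
    assume "x \<in> under a"
    then show "x \<in> underS s"
      using s TRANS ANTISYM unfolding under_def underS_def aboveS_def
      by (auto dest: transD antisymD)
  next
    fix x
    assume x: "x \<in> underS s"
    then have xF: "x \<in> Field r"
      by (auto simp: underS_def Field_def)
    have "x \<notin> aboveS a"
      using x minim_least[OF sub, of x] ANTISYM
      by (auto simp: s_def underS_def dest: antisymD)
    then show "x \<in> under a"
      using not_in_iff[OF xF a] by (auto simp: aboveS_def under_def)
  qed
  then show ?thesis
    using openin_underS[OF sF] by simp
qed

text \<open>The segment \<open>under r a\<close> is both open and compact, so it serves as
  \<open>U\<close> and as \<open>K\<close>.\<close>

lemma locally_compact_order_topology:
  assumes r: "limit_ordinal r"
  shows "locally_compact_space (order_topology_of r)"
  unfolding locally_compact_space_def topspace_order_topology_of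
proof
  fix a
  assume a: "a \<in> Field r"
  interpret wo_rel r
    using r by (rule limit_ordinal_wo_rel)
  have "a \<in> under a"
    using a REFL by (auto simp: under_def refl_on_def)
  then show "\<exists>U K. openin (order_topology_of r) U \<and> compactin (order_topology_of r) K \<and>
      a \<in> U \<and> U \<subseteq> K"
    using openin_under[OF r a] compactin_under by blast
qed

lemma finite_bounded_limit_ordinal:
  assumes r: "limit_ordinal r" and "finite F" "F \<subseteq> Field r"
  shows "\<exists>m \<in> Field r. \<forall>a \<in> F. (a, m) \<in> r"
proof -
  interpret wo_rel r
    using r by (rule limit_ordinal_wo_rel)
  show ?thesis
    using assms(2,3)
  proof (induction F rule: finite_induct)
    case empty
    then show ?case using r by (auto simp: limit_ordinal_def)
  next
    case (insert x F)
    then obtain m where m: "m \<in> Field r" "\<forall>a \<in> F. (a, m) \<in> r"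
      by auto
    show ?case
    proof (cases "(x, m) \<in> r")
      case True
      with m show ?thesis by blast
    next
      case False
      then have mx: "(m, x) \<in> r"
        using TOTALS m(1) insert.prems by blast
      have "(x, x) \<in> r"
        using REFL insert.prems by (auto simp: refl_on_def)
      moreover have "\<forall>a \<in> F. (a, x) \<in> r"
        using m mx TRANS by (blast dest: transD)
      ultimately show ?thesis
        using insert.prems by blast
    qed
  qed
qed

text \<open>Lower open rays cover the field because there is no largest element. An upper bound of
  finitely many endpoints lies in none of their rays.\<close>

lemma not_compact_order_topology:
  assumes r: "limit_ordinal r"
  shows "\<not> compact_space (order_topology_of r)"
proof
  interpret wo_rel r
    using r by (rule limit_ordinal_wo_rel)
  assume compact: "compact_space (order_topology_of r)"
  have cover: "Field r \<subseteq> \<Union> (underS ` Field r)"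
  proof
    fix a
    assume "a \<in> Field r"
    then obtain b where b: "b \<in> aboveS a"
      using limit_ordinal_aboveS[OF r] by blast
    then have "b \<in> Field r" "a \<in> underS b"
      by (auto simp: aboveS_def underS_def Field_def)
    then show "a \<in> \<Union> (underS ` Field r)"
      by blast
  qed
  have "\<forall>U \<in> underS ` Field r. openin (order_topology_of r) U"
    using openin_underS[of _ r] by auto
  with compact cover obtain \<F> where "finite \<F>" "\<F> \<subseteq> underS ` Field r" "Field r \<subseteq> \<Union> \<F>"
    unfolding compact_space_alt topspace_order_topology_of by meson
  then obtain F where F: "F \<subseteq> Field r" "finite F" "Field r \<subseteq> \<Union> (underS ` F)"
    by (metis finite_subset_image)
  obtain m where m: "m \<in> Field r" "\<forall>a \<in> F. (a, m) \<in> r"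
    using finite_bounded_limit_ordinal[OF r F(2,1)] by blast
  then obtain a where "a \<in> F" "m \<in> underS a"
    using F(3) by auto
  with m show False
    using ANTISYM by (auto simp: underS_def dest: antisymD)
qed

section \<open>From UOK to UCR\<close>

text \<open>The limit is taken as the value at infinity. Continuity there holds because a tail of
  the ordinal has its complement inside a compact segment.\<close>

lemma transfinite_limit_extends:
  assumes r: "limit_ordinal r" and f: "continuous_map (order_topology_of r) X f"
    and x: "transfinite_limit r X f x"
  shows "extends_to_Alexandroff (order_topology_of r) X f (case_option x f)"
proof -
  interpret wo_rel r
    using r by (rule limit_ordinal_wo_rel)
  define L where "L = order_topology_of r"
  have xX: "x \<in> topspace X"
    using x by (simp add: transfinite_limit_def)
  have "continuous_map (Alexandroff_compactification L) X (case_option x f)"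
    unfolding continuous_map_def
  proof (intro conjI allI impI)
    show "case_option x f \<in> topspace (Alexandroff_compactification L) \<rightarrow> topspace X"
      using xX f by (auto simp: L_def continuous_map_def Pi_iff)
  next
    fix W
    assume W: "openin X W"
    define V where "V = {a \<in> Field r. f a \<in> W}"
    have V: "openin L V"
      using openin_continuous_map_preimage[OF f W] by (simp add: V_def L_def)
    show "openin (Alexandroff_compactification L)
        {z \<in> topspace (Alexandroff_compactification L). case_option x f z \<in> W}"
    proof (cases "x \<in> W")
      case False
      then have "{z \<in> topspace (Alexandroff_compactification L). case_option x f z \<in> W} = Some ` V"
        by (auto simp: L_def V_def)
      with V show ?thesis by simp
    next
      case True
      with x W obtain b where b: "b \<in> Field r" "\<forall>c \<in> Field r. (b, c) \<in> r \<longrightarrow> f c \<in> W"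
        unfolding transfinite_limit_def by blast
      \<comment> \<open>Open neighbourhoods of \<open>None\<close> are the complements of closed
        compact sets, so both properties are needed for the points of \<open>L\<close> that
        \<open>f\<close> maps outside \<open>W\<close>. Such points lie below \<open>b\<close>,
        hence in the compact set \<open>under b\<close>.\<close>
      have closed: "closedin L (Field r - V)"
        using V closedin_diff[of L "Field r" V] closedin_topspace[of L] by (simp add: L_def)
      have sub: "Field r - V \<subseteq> under b"
        using b TOTALS by (auto simp: V_def under_def)
      have "compactin L (under b)"
        using compactin_under by (simp add: L_def)
      from closed_compactin[OF this sub closed] have "compactin L (Field r - V)" .
      moreover have "{z \<in> topspace (Alexandroff_compactification L). case_option x f z \<in> W} =
          insert None (Some ` (topspace L - (Field r - V)))"
        using True by (auto simp: L_def V_def)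
      ultimately show ?thesis
        unfolding openin_Alexandroff_compactification using closed by blast
    qed
  qed
  then show ?thesis
    by (simp add: extends_to_Alexandroff_def L_def)
qed

lemma UOK_imp_UCR:
  assumes X: "UOK_space TYPE('u) X"
  shows "UCR_space TYPE('u) X"
  unfolding UCR_space_def
proof (intro allI impI, elim conjE)
  fix r :: "'u rel" and f x y
  assume r: "limit_ordinal r" and f: "continuous_map (order_topology_of r) X f"
    and x: "transfinite_limit r X f x" and y: "transfinite_limit r X f y"
  note extends = transfinite_limit_extends[OF r f]
  have "Hausdorff_space (order_topology_of r)"
    using r by (intro wo_rel.Hausdorff_order_topology limit_ordinal_wo_rel)
  then have "\<forall>z \<in> topspace (Alexandroff_compactification (order_topology_of r)).
      case_option x f z = case_option y f z"
    using X[unfolded UOK_space_def, rule_format, of "order_topology_of r" f] r f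
      extends[OF x] extends[OF y]
      not_compact_order_topology locally_compact_order_topology by blast
  \<comment> \<open>At infinity the two extensions take the values \<open>x\<close> and
    \<open>y\<close>.\<close>
  then have "case_option x f None = case_option y f None"
    by (simp only: topspace_Alexandroff_compactification ball_simps)
  then show "x = y"
    by simp
qed

section \<open>The ordinal omega inside the universe, and from UCR to US\<close>

text \<open>Ordinals must be relations on \<open>'u\<close>, so the order of the natural numbers is
  carried over along an injection \<open>e\<close>.\<close>

definition omega_copy :: "(nat \<Rightarrow> 'u) \<Rightarrow> 'u rel" where
  "omega_copy e = (\<lambda>(m, n). (e m, e n)) ` {(m, n). m \<le> n}"

context
  fixes e :: "nat \<Rightarrow> 'u"
  assumes e: "inj e"
begin

lemma omega_copy_iff [simp]: "(e m, e n) \<in> omega_copy e \<longleftrightarrow> m \<le> n"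
  using e by (force simp: omega_copy_def inj_eq)

lemma omega_copyE:
  assumes "(a, b) \<in> omega_copy e"
  obtains m n where "a = e m" "b = e n" "m \<le> n"
  using assms by (auto simp: omega_copy_def)

lemma Field_omega_copy [simp]: "Field (omega_copy e) = range e"
proof (intro set_eqI iffI)
  fix a
  assume "a \<in> range e"
  then obtain n where "a = e n"
    by blast
  then have "(a, a) \<in> omega_copy e"
    by simp
  then show "a \<in> Field (omega_copy e)"
    by (auto simp: Field_def)
qed (auto simp: Field_def elim: omega_copyE)

lemma limit_ordinal_omega_copy: "limit_ordinal (omega_copy e)"
proof -
  have "wf (omega_copy e - Id)"
  proof (rule wf_subset)
    show "wf (inv_image less_than (inv e))"
      by simp
    \<comment> \<open>Well-foundedness is inherited from \<open><\<close> on the natural numbers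
      through \<open>inv e\<close>.\<close>
    show "omega_copy e - Id \<subseteq> inv_image less_than (inv e)"
      using e by (auto elim!: omega_copyE simp: le_less)
  qed
  moreover have "trans (omega_copy e)"
    using e by (auto intro!: transI elim!: omega_copyE simp: inj_eq)
  moreover have "antisym (omega_copy e)"
    using e by (auto intro!: antisymI elim!: omega_copyE simp: inj_eq)
  moreover have "omega_copy e \<subseteq> range e \<times> range e"
    by (auto elim: omega_copyE)
  ultimately have "Well_order (omega_copy e)"
    by (auto simp: well_order_on_def linear_order_on_def partial_order_on_def preorder_on_def
        refl_on_def total_on_def)
  then show ?thesis
    using not_less_eq_eq by (auto simp: limit_ordinal_def)
qed

text \<open>Each \<open>e n\<close> is alone between its predecessor and its successor;
  \<open>e 0\<close> is alone below \<open>e 1\<close>.\<close>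

lemma order_topology_omega_copy: "order_topology_of (omega_copy e) = discrete_topology (range e)"
proof -
  have "openin (order_topology_of (omega_copy e)) {e n}" for n
  proof (cases n)
    case 0
    have "underS (omega_copy e) (e 1) = {e 0}"
      using e by (auto simp: underS_def inj_eq elim!: omega_copyE)
    with 0 openin_underS[of "e 1" "omega_copy e"] show ?thesis by simp
  next
    case (Suc k)
    have "underS (omega_copy e) (e (Suc n)) \<inter> aboveS (omega_copy e) (e k) = {e n}"
      using e Suc by (auto simp: underS_def aboveS_def inj_eq elim!: omega_copyE)
    moreover have "openin (order_topology_of (omega_copy e)) \<dots>"
      using openin_underS[of "e (Suc n)" "omega_copy e"] openin_aboveS[of "e k" "omega_copy e"]
      by (metis Field_omega_copy calculation openin_Int rangeI)
    ultimately show ?thesis by simp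
  qed
  then show ?thesis
    by (simp add: discrete_topology_unique eq_commute[of _ "discrete_topology _"])
qed

text \<open>The bounds \<open>b\<close> are exactly the points \<open>e N\<close>, so tails
  correspond to tails of the sequence \<open>s\<close>.\<close>

lemma transfinite_limit_omega_copy:
  "transfinite_limit (omega_copy e) X (s \<circ> inv e) x \<longleftrightarrow> limitin X s x sequentially"
  using e by (simp add: transfinite_limit_def limitin_def eventually_sequentially)

end

lemma UCR_imp_US:
  assumes universe: "infinite (UNIV :: 'u set)" and X: "UCR_space TYPE('u) X"
  shows "US_space X"
  unfolding US_space_def
proof (intro allI impI, elim conjE exE)
  fix s :: "nat \<Rightarrow> _" and x
  assume s: "range s \<subseteq> topspace X" and x: "limitin X s x sequentially"
  obtain e :: "nat \<Rightarrow> 'u" where e: "inj e"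
    using universe infinite_countable_subset by blast
  \<comment> \<open>On a discrete space every map into \<open>topspace X\<close> is continuous, so
    every sequence is a continuous transfinite sequence.\<close>
  have "continuous_map (order_topology_of (omega_copy e)) X (s \<circ> inv e)"
    using s by (auto simp: order_topology_omega_copy[OF e])
  then have "y = x" if "limitin X s y sequentially" for y
    using X limit_ordinal_omega_copy[OF e] x that
    unfolding UCR_space_def transfinite_limit_omega_copy[OF e, symmetric] by blast
  with x show "\<exists>!x. limitin X s x sequentially"
    by blast
qed

theorem theorem3p1:
  fixes X :: "'a topology"
  assumes universe: "infinite (UNIV :: 'u set)"
  shows "(k2_Hausdorff TYPE('u) X \<longrightarrow> UOK_space TYPE('u) X) \<and>
         (UOK_space TYPE('u) X \<longrightarrow> UCR_space TYPE('u) X) \<and>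
         (UCR_space TYPE('u) X \<longrightarrow> US_space X)"
  using k2_Hausdorff_imp_UOK[OF universe] UOK_imp_UCR UCR_imp_US[OF universe] by blast

end
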